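(* Let $n,m\ge 3$ and let $\mathcal{S}=(s_{1},\ldots,s_{n})$ and $\mathcal{T}=(t_{1},\ldots,t_{m})$ be the $3d$-quiddity sequences of two $3d$-dissections of an $n$-gon and an $m$-gon respectively, which are either both even or both odd. Then each of the $2n$ sequences $\mathcal{S}\circ_{k}\mathcal{T}$ and $\mathcal{S}\bullet_{k}\mathcal{T}$, $k=1,2,\ldots,n$, is a solution in positive integers of the equation $M_{n+m-1}(a_{1},\ldots,a_{n+m-1})=-Id$.
   Context: For a sequence $(a_1,\ldots,a_N)$, $$M_{N}(a_{1},\ldots,a_{N})=\begin{pmatrix} a_{N} & -1\\ 1 & 0\end{pmatrix}\begin{pmatrix} a_{N-1} & -1\\ 1 & 0\end{pmatrix}\cdots\begin{pmatrix} a_{1} & -1\\ 1 & 0\end{pmatrix},$$ and $Id$ is the $2\times 2$ identity matrix. A $3d$-dissection is a partition of a convex $n$-gon (vertices labeled counterclockwise $1,\ldots,n$) into sub-polygons by means of pairwise non-crossing diagonals such that the number of vertices of every sub-polygon is a multiple of $3$. Its $3d$-quiddity sequence is $(a_1,\ldots,a_n)$ where $a_i$ is the number of sub-polygons adjacent to vertex $i$. A $3d$-dissection is even if the total number of its sub-polygons with an even number of vertices ($6$-gons, $12$-gons, ...) is even; otherwise it is odd. Products: for $1\le k\le n-1$, $$\mathcal{S}\circ_{k}\mathcal{T}=(s_{1},\ldots,s_{k-1}, s_{k}+t_{1}+1,t_{2},\ldots,t_{m-1}, t_{m}+1, s_{k+1}+1,s_{k+2},\ldots,s_{n}),$$ $$\mathcal{S}\circ_{n}\mathcal{T}=(s_{1}+1,s_{2},\ldots,s_{n-1},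 s_{n}+t_{1}+1,t_{2},\ldots,t_{m-1}, t_{m}+1);$$ for $2\le k\le n$, $$\mathcal{S}\bullet_{k}\mathcal{T}=(s_{1},\ldots,s_{k-2},s_{k-1}+1,t_{2}+1,t_{3},\ldots,t_{m},s_{k}+t_{1}+1,s_{k+1},\ldots,s_{n}),$$ $$\mathcal{S}\bullet_{1}\mathcal{T}=(s_{1}+t_{1}+1,s_{2},\ldots,s_{n-1},s_{n}+1,t_{2}+1,t_{3},\ldots,t_{m}).$$ *)

theory Defs
  imports "HOL-Analysis.Analysis"
begin

definition elem_mat :: "int \<Rightarrow> int^2^2" where
  "elem_mat a = vector [vector [a, -1], vector [1, 0]]"

text \<open>The factor of the first entry is the rightmost one.\<close>

primrec M :: "int list \<Rightarrow> int^2^2" where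
  "M [] = mat 1"
| "M (a # as) = M as ** elem_mat a"

definition positive_solution :: "nat \<Rightarrow> int list \<Rightarrow> bool" where
  "positive_solution N as \<longleftrightarrow> length as = N \<and> (\<forall>a\<in>set as. 0 < a) \<and> M as = - mat 1"

text \<open>
  The vertices of the convex \<open>n\<close>-gon are \<open>1, \<dots>, n\<close> in cyclic order. A convex polygon spanned by
  some of these vertices is represented by its vertex set \<open>P\<close>, and a segment by the set of its two
  end points. Two vertices of \<open>P\<close> are joined by a side of \<open>P\<close> if they are neighbours in the cyclic
  order of \<open>P\<close>: no vertex of \<open>P\<close> lies between them, or all other ones do.
\<close>

definition chords :: "nat set \<Rightarrow> nat set set" where
  "chords P = {{i, j} | i j. i \<in> P \<and> j \<in> P \<and> i < j}"

definition sides :: "nat set \<Rightarrow> nat set set" where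
  "sides P = {{i, j} | i j. i \<in> P \<and> j \<in> P \<and> i < j \<and> (P \<inter> {i<..<j} = {} \<or> P \<subseteq> {i..j})}"

definition diagonals :: "nat set \<Rightarrow> nat set set" where
  "diagonals P = chords P - sides P"

definition crossing :: "nat set \<Rightarrow> nat set \<Rightarrow> bool" where
  "crossing d e \<longleftrightarrow> (\<exists>i j k l. i < k \<and> k < j \<and> j < l \<and>
     (d = {i, j} \<and> e = {k, l} \<or> d = {k, l} \<and> e = {i, j}))"

definition dissection :: "nat \<Rightarrow> nat set set \<Rightarrow> bool" where
  "dissection n D \<longleftrightarrow> D \<subseteq> diagonals {1..n} \<and> (\<forall>d\<in>D. \<forall>e\<in>D. \<not> crossing d e)"

text \<open>
  The pieces into which the diagonals in \<open>D\<close> cut the \<open>n\<close>-gon: polygons bounded by sides of the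
  \<open>n\<close>-gon and members of \<open>D\<close> that are not cut any further by a member of \<open>D\<close>. A member of \<open>D\<close>
  that meets the interior of such a polygon but is not one of its diagonals would cross one of its
  sides, which is impossible in a dissection.
\<close>

definition subpolygons :: "nat \<Rightarrow> nat set set \<Rightarrow> nat set set" where
  "subpolygons n D = {P. P \<subseteq> {1..n} \<and> 3 \<le> card P \<and>
     sides P \<subseteq> sides {1..n} \<union> D \<and> diagonals P \<inter> D = {}}"

definition dissection_3d :: "nat \<Rightarrow> nat set set \<Rightarrow> bool" where
  "dissection_3d n D \<longleftrightarrow> dissection n D \<and> (\<forall>P\<in>subpolygons n D. 3 dvd card P)"

definition even_dissection :: "nat \<Rightarrow> nat set set \<Rightarrow> bool" where
  "even_dissection n D \<longleftrightarrow> even (card {P \<in> subpolygons n D. even (card P)})"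

definition quiddity :: "nat \<Rightarrow> nat set set \<Rightarrow> int list" where
  "quiddity n D = map (\<lambda>i. int (card {P \<in> subpolygons n D. i \<in> P})) [1..<n+1]"

text \<open>
  List positions start at \<open>0\<close>, so \<open>s i\<close> and \<open>t i\<close> below are the entries with index \<open>i\<close> counted
  from \<open>1\<close>. The products are meant for \<open>1 \<le> k \<le> n\<close> only.
\<close>

definition circ_prod :: "nat \<Rightarrow> int list \<Rightarrow> int list \<Rightarrow> int list" where
  "circ_prod k S T =
    (let n = length S; m = length T; s = (\<lambda>i. S ! (i - 1)); t = (\<lambda>i. T ! (i - 1)) in
     if k < n then
       map s [1..<k] @ [s k + t 1 + 1] @ map t [2..<m] @ [t m + 1, s (k + 1) + 1]
         @ map s [k+2..<n+1]
     else
       [s 1 + 1] @ map s [2..<n] @ [s n + t 1 + 1] @ map t [2..<m] @ [t m + 1])"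

definition bullet_prod :: "nat \<Rightarrow> int list \<Rightarrow> int list \<Rightarrow> int list" where
  "bullet_prod k S T =
    (let n = length S; m = length T; s = (\<lambda>i. S ! (i - 1)); t = (\<lambda>i. T ! (i - 1)) in
     if 2 \<le> k then
       map s [1..<k-1] @ [s (k - 1) + 1, t 2 + 1] @ map t [3..<m+1] @ [s k + t 1 + 1]
         @ map s [k+1..<n+1]
     else
       [s 1 + t 1 + 1] @ map s [2..<n] @ [s n + 1, t 2 + 1] @ map t [3..<m+1])"

end

theory Submission
  imports Defs
begin

text \<open>
  The quiddity of a \<open>3d\<close>-dissection with \<open>e\<close> pieces having evenly many vertices satisfies
  \<open>M = (-1)\<^sup>e\<^sup>+\<^sup>1 Id\<close>. This is shown by cutting off ears: a diagonal \<open>{a, b}\<close> with \<open>b - a\<close> minimal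
  cuts off a single piece, whose inner vertices contribute a block of \<open>3 i + 1\<close> ones to the
  quiddity. As \<open>E(1)\<^sup>3 = -Id\<close> and \<open>E(b + 1) E(1) E(a + 1) = E(b) E(a)\<close> for the elementary matrices,
  removing the ear changes \<open>M\<close> by the factor \<open>(-1)\<^sup>i\<close>, and the piece has \<open>3 i + 3\<close> vertices.

  The products glue both polygons to the sides of a triangle. Since \<open>E(a + b) = -E(a) E(0) E(b)\<close>
  and \<open>E(0)\<^sup>2 = -Id\<close>, gluing in a sequence with \<open>M = c Id\<close> multiplies \<open>M\<close> by \<open>-c\<close>, and two
  dissections of the same parity have the same \<open>c = \<plusminus>1\<close>.
\<close>

section \<open>Two-by-two integer matrices and the elementary factors\<close>

lemma mat_mult_2:
  fixes A B :: "int^2^2"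
  shows "A ** B = (vector [vector [A$1$1 * B$1$1 + A$1$2 * B$2$1, A$1$1 * B$1$2 + A$1$2 * B$2$2],
     vector [A$2$1 * B$1$1 + A$2$2 * B$2$1, A$2$1 * B$1$2 + A$2$2 * B$2$2]])"
  by (simp add: vec_eq_iff forall_2 matrix_matrix_mult_def sum_2)

lemma mat_2: "(mat c :: int^2^2) = vector [vector [c, 0], vector [0, c]]"
  by (simp add: vec_eq_iff forall_2 mat_def)

lemmas matrix_2_simps = mat_mult_2 mat_2 elem_mat_def vec_eq_iff forall_2

lemma neg_mat: "- mat c = (mat (- c) :: int^2^2)"
  by (simp add: vec_eq_iff mat_def)

lemma mat_commute: "A ** mat c = mat c ** (A :: int^2^2)"
  by (simp add: matrix_2_simps)

lemma mat_mult_mat: "mat c ** mat d = (mat (c * d) :: int^2^2)"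
  by (simp add: matrix_2_simps)

lemma elem_mat_ear: "elem_mat (b + 1) ** elem_mat 1 ** elem_mat (a + 1) = elem_mat b ** elem_mat a"
  by (simp add: matrix_2_simps algebra_simps)

lemma elem_mat_1_cube: "elem_mat 1 ** elem_mat 1 ** elem_mat 1 = mat (- 1)"
  by (simp add: matrix_2_simps)

lemma elem_mat_add: "elem_mat (a + b) = mat (- 1) ** elem_mat a ** elem_mat 0 ** elem_mat b"
  by (simp add: matrix_2_simps)

lemma M_append: "M (xs @ ys) = M ys ** M xs"
  by (induction xs) (simp_all add: matrix_mul_assoc)

lemma invertible_elem_mat: "invertible (elem_mat a)"
  unfolding invertible_def
  \<comment> \<open>The determinant is 1, so the inverse is the adjugate.\<close>
  by (rule exI[of _ "vector [vector [0, 1], vector [-1, a]]"]) (simp add: matrix_2_simps)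

lemma invertible_M: "invertible (M xs)"
proof (induction xs)
  case Nil
  show ?case by (auto simp: invertible_def)
next
  case (Cons a xs)
  then show ?case by (simp add: invertible_mult invertible_elem_mat)
qed

text \<open>The two products are conjugate by the invertible matrix \<open>M xs\<close>, and
  conjugation fixes scalar matrices. This makes the equation cyclic, which the products wrapping
  around the end of a sequence require.\<close>

lemma M_rotate:
  assumes "M (xs @ ys) = mat c"
  shows "M (ys @ xs) = mat c"
proof -
  obtain N where N: "M xs ** N = mat 1"
    using invertible_M[of xs] unfolding invertible_def by blast
  have "M (ys @ xs) = M xs ** M ys ** (M xs ** N)"
    by (simp add: M_append N)
  also have "\<dots> = M xs ** (M ys ** M xs) ** N"
    by (simp only: matrix_mul_assoc)
  also have "\<dots> = M xs ** mat c ** N"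
    using assms by (simp only: M_append)
  also have "\<dots> = mat c ** (M xs ** N)"
    by (simp only: mat_commute matrix_mul_assoc)
  finally show ?thesis by (simp add: N)
qed

lemma M_replicate_1: "M (replicate (3 * i + 1) 1) = mat ((- 1) ^ i) ** elem_mat 1"
proof (induction i)
  case (Suc i)
  have "replicate (3 * Suc i + 1) (1::int) = replicate (3 * i + 1) 1 @ replicate 3 1"
    unfolding replicate_add[symmetric] by simp
  then have "replicate (3 * Suc i + 1) (1::int) = replicate (3 * i + 1) 1 @ [1, 1, 1]"
    by (simp only: numeral_3_eq_3 replicate.simps)
  then have "M (replicate (3 * Suc i + 1) 1)
      = elem_mat 1 ** elem_mat 1 ** elem_mat 1 ** M (replicate (3 * i + 1) 1)"
    by (simp only: M_append) (simp add: matrix_mul_assoc)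
  also have "\<dots> = mat (- 1) ** mat ((- 1) ^ i) ** elem_mat 1"
    by (simp only: elem_mat_1_cube Suc.IH matrix_mul_assoc)
  finally show ?case
    by (simp add: mat_mult_mat)
qed simp

section \<open>Effect of local changes of a sequence on its matrix\<close>

text \<open>The block of ones collapses to \<open>elem_mat 1\<close> up to sign, and
  \<open>elem_mat_ear\<close> absorbs that factor together with the two increments at its
  neighbours.\<close>

lemma M_insert_ear:
  "M (A @ [a + 1] @ replicate (3 * i + 1) 1 @ [b + 1] @ B) = mat ((- 1) ^ i) ** M (A @ [a, b] @ B)"
proof -
  have "M (A @ [a + 1] @ replicate (3 * i + 1) 1 @ [b + 1] @ B)
      = M B ** elem_mat (b + 1) ** (mat ((- 1) ^ i) ** elem_mat 1) ** elem_mat (a + 1) ** M A"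
    unfolding M_append M_replicate_1 by (simp add: matrix_mul_assoc)
  also have "\<dots> = mat ((- 1) ^ i) ** M B ** (elem_mat (b + 1) ** elem_mat 1 ** elem_mat (a + 1)) ** M A"
    by (simp only: matrix_mul_assoc mat_commute)
  finally show ?thesis
    unfolding elem_mat_ear by (simp add: M_append matrix_mul_assoc)
qed

text \<open>Splitting both outer factors with \<open>elem_mat_add\<close> isolates the product
  assumed to be scalar; the two signs cancel, and the two factors \<open>elem_mat 0\<close> meet and
  contribute -1.\<close>

lemma elem_mat_glue:
  assumes "elem_mat v ** X ** elem_mat u = mat c"
  shows "elem_mat (x + v) ** X ** elem_mat (y + u) = mat (- c) ** elem_mat x ** elem_mat y"
proof -
  have "elem_mat (x + v) ** X ** elem_mat (y + u)
      = elem_mat (x + v) ** X ** elem_mat (u + y)" by (simp add: add.commute)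
  also have "\<dots> = elem_mat x ** elem_mat 0 ** (elem_mat v ** X ** elem_mat u) ** elem_mat 0 ** elem_mat y"
    by (simp add: elem_mat_add) (simp add: matrix_2_simps algebra_simps)
  also have "\<dots> = mat (- c) ** elem_mat x ** elem_mat y"
    unfolding assms by (simp add: matrix_2_simps)
  finally show ?thesis .
qed

text \<open>The inserted triangle has a new apex and base vertices with entries \<open>s\<close> and
  \<open>s'\<close>. In \<open>M_circ\<close> the side of the second polygon between
  \<open>v\<close> and \<open>u\<close> is glued to the triangle side from \<open>s\<close> to the
  apex, in \<open>M_bullet\<close> to the side from the apex to \<open>s'\<close>. Gluing reduces
  the apex to \<open>elem_mat 1\<close>, an ear that \<open>elem_mat_ear\<close> removes.\<close>

lemma
  assumes "M (u # X @ [v]) = mat c"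
  shows M_circ: "M (A @ [s + u + 1] @ X @ [v + 1, s' + 1] @ B) = mat (- c) ** M (A @ [s, s'] @ B)"
    and M_bullet: "M (A @ [s + 1, u + 1] @ X @ [s' + v + 1] @ B) = mat (- c) ** M (A @ [s, s'] @ B)"
proof -
  have uv: "elem_mat v ** M X ** elem_mat u = mat c"
    using assms by (simp add: M_append)
  \<comment> \<open>The summand 1 next to \<open>v\<close> is the triangle at the apex; the 1 in
    \<open>s + 1\<close> is the same triangle at its base.\<close>
  have "elem_mat (v + 1) ** M X ** elem_mat (s + u + 1) = mat (- c) ** elem_mat 1 ** elem_mat (s + 1)"
    using elem_mat_glue[OF uv, of 1 "s + 1"] by (simp add: ac_simps)
  then have "elem_mat (s' + 1) ** (elem_mat (v + 1) ** M X ** elem_mat (s + u + 1))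
      = mat (- c) ** (elem_mat (s' + 1) ** elem_mat 1 ** elem_mat (s + 1))"
    by (simp only: matrix_mul_assoc mat_commute)
  then have 1: "elem_mat (s' + 1) ** elem_mat (v + 1) ** M X ** elem_mat (s + u + 1)
      = mat (- c) ** (elem_mat s' ** elem_mat s)"
    by (simp only: elem_mat_ear matrix_mul_assoc)
  have "elem_mat (s' + v + 1) ** M X ** elem_mat (u + 1) = mat (- c) ** elem_mat (s' + 1) ** elem_mat 1"
    using elem_mat_glue[OF uv, of "s' + 1" 1] by (simp add: ac_simps)
  then have "elem_mat (s' + v + 1) ** M X ** elem_mat (u + 1) ** elem_mat (s + 1)
      = mat (- c) ** (elem_mat (s' + 1) ** elem_mat 1 ** elem_mat (s + 1))"
    by (simp only: matrix_mul_assoc)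
  then have 2: "elem_mat (s' + v + 1) ** M X ** elem_mat (u + 1) ** elem_mat (s + 1)
      = mat (- c) ** (elem_mat s' ** elem_mat s)"
    by (simp only: elem_mat_ear)
  have "M (A @ [s + u + 1] @ X @ [v + 1, s' + 1] @ B)
      = M B ** (elem_mat (s' + 1) ** elem_mat (v + 1) ** M X ** elem_mat (s + u + 1)) ** M A"
    by (simp add: M_append matrix_mul_assoc)
  then show "M (A @ [s + u + 1] @ X @ [v + 1, s' + 1] @ B) = mat (- c) ** M (A @ [s, s'] @ B)"
    unfolding 1 by (simp add: M_append matrix_mul_assoc mat_commute)
  have "M (A @ [s + 1, u + 1] @ X @ [s' + v + 1] @ B)
      = M B ** (elem_mat (s' + v + 1) ** M X ** elem_mat (u + 1) ** elem_mat (s + 1)) ** M A"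
    by (simp add: M_append matrix_mul_assoc)
  then show "M (A @ [s + 1, u + 1] @ X @ [s' + v + 1] @ B) = mat (- c) ** M (A @ [s, s'] @ B)"
    unfolding 2 by (simp add: M_append matrix_mul_assoc mat_commute)
qed

section \<open>Sides, diagonals and crossings of vertex sets\<close>

lemma pair_in_chords: "i < j \<Longrightarrow> {i, j} \<in> chords P \<longleftrightarrow> i \<in> P \<and> j \<in> P"
  by (auto simp: chords_def doubleton_eq_iff)

lemma pair_in_sides:
  "i < j \<Longrightarrow> {i, j} \<in> sides P \<longleftrightarrow> i \<in> P \<and> j \<in> P \<and> (P \<inter> {i<..<j} = {} \<or> P \<subseteq> {i..j})"
  unfolding sides_def mem_Collect_eq doubleton_eq_iff by (metis less_asym)

lemma pair_in_diagonals:
  "i < j \<Longrightarrow> {i, j} \<in> diagonals P \<longleftrightarrow> i \<in> P \<and> j \<in> P \<and> P \<inter> {i<..<j} \<noteq> {} \<and> \<not> P \<subseteq> {i..j}"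
  unfolding diagonals_def Diff_iff by (simp add: pair_in_chords pair_in_sides) blast

lemma sides_subset_chords: "sides P \<subseteq> chords P"
  by (auto simp: sides_def chords_def)

lemma diagonals_subset_chords: "diagonals P \<subseteq> chords P"
  by (auto simp: diagonals_def)

lemma chordsE:
  assumes "d \<in> chords P"
  obtains i j where "d = {i, j}" "i < j" "i \<in> P" "j \<in> P"
  using assms by (auto simp: chords_def)

lemma chords_mono: "P \<subseteq> V \<Longrightarrow> chords P \<subseteq> chords V"
  by (auto simp: chords_def)

lemma crossing_pairI:
  "i < k \<Longrightarrow> k < j \<Longrightarrow> j < l \<Longrightarrow> crossing {i, j} {k, l}"
  "i < k \<Longrightarrow> k < j \<Longrightarrow> j < l \<Longrightarrow> crossing {k, l} {i, j}"
  by (auto simp: crossing_def)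

text \<open>A side leaves all other vertices in one of the two arcs between its end points, whereas
  a crossing chord has one end point in each arc.\<close>

lemma side_not_crossing_chord:
  assumes "d \<in> sides V" "e \<in> chords V"
  shows "\<not> crossing d e"
proof
  assume "crossing d e"
  then obtain i j k l where ijkl: "i < k" "k < j" "j < l"
    "d = {i, j} \<and> e = {k, l} \<or> d = {k, l} \<and> e = {i, j}"
    unfolding crossing_def by blast
  then have "i < j" "k < l" by auto
  then have "i \<in> V" "j \<in> V" "k \<in> V" "l \<in> V"
    using ijkl assms sides_subset_chords[of V] pair_in_chords[of i j V] pair_in_chords[of k l V] by blast+
  then show False
    using ijkl(4) assms(1) ijkl(1-3) pair_in_sides[OF \<open>i < j\<close>, of V] pair_in_sides[OF \<open>k < l\<close>, of V]
    by fastforce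
qed

text \<open>A discrete intermediate value principle: the last element up to \<open>w\<close> and the
  first one beyond it span a side that jumps over the gap.\<close>

lemma gap_in_finite_set:
  fixes P :: "nat set"
  assumes "finite P" "x \<in> P" "y \<in> P" "x \<le> w" "w < y"
  obtains p q where "p \<in> P" "q \<in> P" "p \<le> w" "w < q" "P \<inter> {p<..<q} = {}" "{p, q} \<in> sides P"
proof -
  let ?L = "P \<inter> {..w}" and ?R = "P \<inter> {w<..}"
  have fin: "finite ?L" "?L \<noteq> {}" "finite ?R" "?R \<noteq> {}" using assms by auto
  define p q where "p = Max ?L" and "q = Min ?R"
  have "p \<in> ?L" "q \<in> ?R" unfolding p_def q_def using fin Max_in Min_in by blast+
  moreover have "\<And>z. z \<in> ?L \<Longrightarrow> z \<le> p" "\<And>z. z \<in> ?R \<Longrightarrow> q \<le> z"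
    unfolding p_def q_def using fin by auto
  ultimately have "p \<in> P" "q \<in> P" "p \<le> w" "w < q" "P \<inter> {p<..<q} = {}"
    by (auto simp: not_le[symmetric]) (meson greaterThan_iff IntI atMost_iff not_le)
  then show thesis using that[of p q] pair_in_sides[of p q P] by simp
qed

lemma Min_Max_side:
  assumes "finite P" "2 \<le> card P"
  shows "Min P < Max P" "{Min P, Max P} \<in> sides P"
proof -
  have "P \<noteq> {}" using assms by auto
  show "Min P < Max P"
  proof (rule ccontr)
    assume "\<not> Min P < Max P"
    then have "P \<subseteq> {Min P}" using assms(1) Min_le Max_ge by (metis le_antisym not_le order_trans singletonI subsetI)
    then have "card P \<le> 1" using card_mono[of "{Min P}" P] by simp
    then show False using assms by simp
  qed
  then show "{Min P, Max P} \<in> sides P"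
    using assms(1) \<open>P \<noteq> {}\<close> by (auto simp: pair_in_sides)
qed

text \<open>The closing side from \<open>Min P\<close> to \<open>Max P\<close> is a side of
  \<open>W\<close> with a vertex of \<open>P\<close> strictly inside, so it encloses
  \<open>W\<close>. A vertex \<open>w\<close> missed by \<open>P\<close> then lies strictly between
  neighbours \<open>p\<close> and \<open>q\<close> of \<open>P\<close>. As \<open>{p, q}\<close> is
  a side of \<open>W\<close>, all of \<open>W\<close> lies in \<open>{p..q}\<close>, which leaves
  \<open>P\<close> only two vertices.\<close>

lemma polygon_eq_if_sides_subset:
  assumes "finite W" "P \<subseteq> W" "3 \<le> card P" "sides P \<subseteq> sides W"
  shows "P = W"
proof (rule ccontr)
  assume "P \<noteq> W"
  then obtain w where w: "w \<in> W" "w \<notin> P" using assms(2) by blast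
  have fin: "finite P" using assms finite_subset by blast
  have not2: "\<not> P \<subseteq> {x, y}" for x y
  proof
    assume "P \<subseteq> {x, y}"
    then have "card P \<le> card {x, y}" by (intro card_mono) auto
    also have "\<dots> \<le> 2" by (simp add: card_insert_if)
    finally show False using assms(3) by simp
  qed
  have "P \<noteq> {}" using not2 by auto
  have mm: "Min P < Max P" "{Min P, Max P} \<in> sides W"
    using Min_Max_side[OF fin] assms by auto
  have "\<not> P \<inter> {Min P<..<Max P} = {}"
  proof
    assume e: "P \<inter> {Min P<..<Max P} = {}"
    have "x \<in> {Min P, Max P}" if "x \<in> P" for x
    proof -
      have "Min P \<le> x" "x \<le> Max P" using fin that by auto
      moreover have "x \<notin> {Min P<..<Max P}" using e that by blast
      ultimately show ?thesis by auto
    qed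
    then show False using not2[of "Min P" "Max P"] by blast
  qed
  then have "W \<subseteq> {Min P..Max P}"
    using mm assms(2) by (auto simp: pair_in_sides)
  moreover have "w \<noteq> Max P"
    using w Max_in[OF fin \<open>P \<noteq> {}\<close>] by blast
  ultimately have "Min P \<le> w" "w < Max P"
    using w by force+
  then obtain p q where pq: "p \<in> P" "q \<in> P" "p \<le> w" "w < q" "P \<inter> {p<..<q} = {}" "{p, q} \<in> sides P"
    using gap_in_finite_set[OF fin, of "Min P" "Max P" w] fin \<open>P \<noteq> {}\<close> by auto
  then have "p < w" using w by (metis le_neq_implies_less)
  then have "W \<subseteq> {p..q}"
    using pq assms(4) w pair_in_sides[of p q W] by fastforce
  then have "P \<subseteq> {p, q}" using pq(5) assms(2) by fastforce
  then show False using not2 by blast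
qed

section \<open>Pieces of a dissection on an arbitrary vertex set\<close>

text \<open>
  The vertex set is arbitrary because cutting off an ear of \<open>{1..n}\<close> does not leave an interval.
\<close>

definition pieces :: "nat set \<Rightarrow> nat set set \<Rightarrow> nat set set" where
  "pieces V D = {P. P \<subseteq> V \<and> 3 \<le> card P \<and> sides P \<subseteq> sides V \<union> D \<and> diagonals P \<inter> D = {}}"

lemma finite_pieces: "finite V \<Longrightarrow> finite (pieces V D)"
  by (rule finite_subset[of _ "Pow V"]) (auto simp: pieces_def)

lemma subpolygons_eq_pieces: "subpolygons n D = pieces {1..n} D"
  by (simp add: subpolygons_def pieces_def)

lemma pieces_empty:
  assumes "finite V" "3 \<le> card V"
  shows "pieces V {} = {V}"
  using assms polygon_eq_if_sides_subset[OF assms(1)] by (auto simp: pieces_def)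

lemma card_ge_3I:
  fixes A :: "nat set"
  assumes "finite A" "x \<in> A" "y \<in> A" "z \<in> A" "x \<noteq> y" "y \<noteq> z" "x \<noteq> z"
  shows "3 \<le> card A"
  using card_mono[of A "{x, y, z}"] assms by simp

section \<open>Cutting off an ear\<close>

text \<open>An ear is not restricted to a triangle. By \<open>minimal\<close>, no further member of
  \<open>D\<close> has both end points in \<open>{a..b}\<close>, so the polygon \<open>tip\<close>
  beyond \<open>{a, b}\<close> is uncut; in \<open>rest\<close> the segment \<open>{a, b}\<close>
  becomes a side.\<close>

locale ear =
  fixes V :: "nat set" and D :: "nat set set" and a b :: nat
  assumes fin: "finite V" and ab: "a < b" "{a, b} \<in> D" and diag: "D \<subseteq> diagonals V"
    and noncrossing: "\<And>d e. d \<in> D \<Longrightarrow> e \<in> D \<Longrightarrow> \<not> crossing d e"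
    and minimal: "\<And>i j. i < j \<Longrightarrow> {i, j} \<in> D \<Longrightarrow> a \<le> i \<Longrightarrow> j \<le> b \<Longrightarrow> i = a \<and> j = b"
begin

definition tip where "tip = V \<inter> {a..b}"
definition rest where "rest = V - {a<..<b}"
definition rest_diags where "rest_diags = D - {{a, b}}"

lemma ab_diag: "a \<in> V" "b \<in> V" "V \<inter> {a<..<b} \<noteq> {}" "\<not> V \<subseteq> {a..b}"
  using ab diag pair_in_diagonals[of a b V] by blast+

lemma D_chords: "D \<subseteq> chords V"
  using diag diagonals_subset_chords by blast

lemma card_tip: "3 \<le> card tip"
proof -
  obtain c where "c \<in> V" "a < c" "c < b" using ab_diag(3) by auto
  then show ?thesis using ab_diag ab fin by (intro card_ge_3I[of tip a b c]) (auto simp: tip_def)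
qed

lemma card_rest: "3 \<le> card rest"
proof -
  obtain c where "c \<in> V" "c \<notin> {a..b}" using ab_diag(4) by blast
  then show ?thesis using ab_diag ab fin by (intro card_ge_3I[of rest a b c]) (auto simp: rest_def)
qed

text \<open>A chord that becomes a side only by the removal has a removed vertex strictly inside,
  but neither \<open>a\<close> nor \<open>b\<close>. Its end points avoid \<open>{a<..<b}\<close>,
  so it is \<open>{a, b}\<close>. A chord enclosing \<open>rest\<close> encloses \<open>a\<close>
  and \<open>b\<close>, hence also the removed vertices.\<close>

lemma sides_rest:
  assumes "c \<in> chords rest"
  shows "c \<in> sides rest \<longleftrightarrow> c \<in> sides V \<or> c = {a, b}"
proof -
  obtain i j where c: "c = {i, j}" "i < j" "i \<in> rest" "j \<in> rest"
    using assms by (rule chordsE)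
  have V: "i \<in> V" "j \<in> V" using c by (auto simp: rest_def)
  have "(rest \<inter> {i<..<j} = {} \<or> rest \<subseteq> {i..j}) \<longleftrightarrow>
     (V \<inter> {i<..<j} = {} \<or> V \<subseteq> {i..j}) \<or> i = a \<and> j = b"
  proof (intro iffI; elim disjE)
    assume e: "rest \<inter> {i<..<j} = {}"
    then have "a \<notin> {i<..<j}" "b \<notin> {i<..<j}" using ab_diag ab by (auto simp: rest_def)
    show "(V \<inter> {i<..<j} = {} \<or> V \<subseteq> {i..j}) \<or> i = a \<and> j = b"
    proof (cases "V \<inter> {i<..<j} = {}")
      case False
      then obtain x where "x \<in> V" "i < x" "x < j" by auto
      moreover have "x \<notin> rest" using e calculation by auto
      ultimately have x: "i < x" "x < j" "a < x" "x < b" by (auto simp: rest_def)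
      have "i \<notin> {a<..<b}" "j \<notin> {a<..<b}" using c by (auto simp: rest_def)
      then show ?thesis using x \<open>a \<notin> {i<..<j}\<close> \<open>b \<notin> {i<..<j}\<close> by auto
    qed blast
  next
    assume e: "rest \<subseteq> {i..j}"
    moreover have "a \<in> rest" "b \<in> rest" using ab_diag by (auto simp: rest_def)
    ultimately have "i \<le> a" "b \<le> j" by auto
    with e have "V \<subseteq> {i..j}" by (fastforce simp: rest_def)
    then show "(V \<inter> {i<..<j} = {} \<or> V \<subseteq> {i..j}) \<or> i = a \<and> j = b" by blast
  qed (auto simp: rest_def)
  then show ?thesis
    using c V ab by (auto simp: pair_in_sides doubleton_eq_iff)
qed

text \<open>An end point strictly between \<open>a\<close> and \<open>b\<close> would force the
  other one into \<open>{a..b}\<close>, as otherwise the diagonal crosses \<open>{a, b}\<close>;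
  minimality forbids that.\<close>

lemma rest_diags: "rest_diags \<subseteq> diagonals rest"
proof
  fix d assume d: "d \<in> rest_diags"
  then have dD: "d \<in> D" "d \<noteq> {a, b}" by (auto simp: rest_diags_def)
  then obtain i j where ij: "d = {i, j}" "i < j" "i \<in> V" "j \<in> V"
    using D_chords chordsE by blast
  have nc: "\<not> crossing {i, j} {a, b}" using noncrossing dD ij ab by blast
  have "\<not> (a \<le> i \<and> j \<le> b)" using minimal[of i j] dD ij by auto
  then have "i \<notin> {a<..<b}" "j \<notin> {a<..<b}"
    using nc crossing_pairI(2)[of a i b j] crossing_pairI(1)[of i a j b] by force+
  then have "d \<in> chords rest" using ij by (simp add: pair_in_chords rest_def)
  moreover have "d \<notin> sides V" using dD diag by (auto simp: diagonals_def)
  ultimately show "d \<in> diagonals rest" using sides_rest dD by (auto simp: diagonals_def)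
qed

text \<open>By minimality the only member of \<open>D\<close> among these chords is
  \<open>{a, b}\<close>, which bounds \<open>tip\<close>; sides of \<open>V\<close> remain sides in
  a subset containing their end points.\<close>

lemma chords_tip:
  assumes "c \<in> chords tip" "c \<in> sides V \<union> D"
  shows "c \<in> sides tip"
proof -
  obtain i j where c: "c = {i, j}" "i < j" "i \<in> tip" "j \<in> tip"
    using assms(1) by (rule chordsE)
  show ?thesis
  proof (cases "c \<in> D")
    case True
    then have "i = a \<and> j = b" using minimal c by (auto simp: tip_def)
    then show ?thesis using c by (auto simp: pair_in_sides tip_def)
  next
    case False
    then show ?thesis using assms c by (auto simp: pair_in_sides tip_def)
  qed
qed

lemma tip_in_pieces: "tip \<in> pieces V D"
proof -
  have "c \<in> sides V \<union> D" if s: "c \<in> sides tip" for c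
  proof -
    obtain i j where c: "c = {i, j}" "i < j" "i \<in> tip" "j \<in> tip"
      using s sides_subset_chords chordsE by blast
    have at: "a \<in> tip" "b \<in> tip" using ab ab_diag by (auto simp: tip_def)
    have "tip \<inter> {i<..<j} = {} \<or> tip \<subseteq> {i..j}" using s c by (simp add: pair_in_sides)
    then show ?thesis
    proof
      assume "tip \<inter> {i<..<j} = {}"
      moreover have "{i<..<j} \<subseteq> {a..b}" using c by (auto simp: tip_def)
      ultimately have "V \<inter> {i<..<j} = {}" unfolding tip_def by blast
      then show ?thesis using c by (auto simp: pair_in_sides tip_def)
    next
      assume "tip \<subseteq> {i..j}"
      then have "i \<le> a" "b \<le> j" using at by auto
      moreover have "a \<le> i" "j \<le> b" using c by (auto simp: tip_def)
      ultimately have "i = a" "j = b" by auto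
      then show ?thesis using ab c by simp
    qed
  qed
  moreover have "diagonals tip \<inter> D = {}"
    using chords_tip by (auto simp: diagonals_def)
  ultimately show ?thesis using card_tip by (auto simp: pieces_def tip_def)
qed

text \<open>Such a piece has a vertex \<open>c\<close> strictly between \<open>a\<close> and
  \<open>b\<close>. If it also had a vertex outside \<open>{a..b}\<close>, then, its sides not
  crossing \<open>{a, b}\<close>, both \<open>a\<close> and \<open>b\<close> would be vertices of it
  and \<open>{a, b}\<close> one of its diagonals. So it lies within \<open>tip\<close>, and its
  sides are sides of \<open>tip\<close>.\<close>

lemma piece_eq_tip:
  assumes "P \<in> pieces V D" "\<not> P \<subseteq> rest"
  shows "P = tip"
proof -
  have P: "P \<subseteq> V" "3 \<le> card P" "sides P \<subseteq> sides V \<union> D" "diagonals P \<inter> D = {}"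
    using assms by (auto simp: pieces_def)
  have finP: "finite P" using P fin finite_subset by blast
  obtain c where c: "c \<in> P" "a < c" "c < b" using assms(2) P by (auto simp: rest_def)
  have nc: "\<not> crossing d {a, b}" if "d \<in> sides P" for d
    using that P(3) noncrossing ab side_not_crossing_chord[of d V "{a, b}"] D_chords by blast
  have mm: "Min P < Max P" "{Min P, Max P} \<in> sides P" using Min_Max_side finP P by auto
  have mmc: "Min P \<le> c" "c \<le> Max P" using finP c by auto
  have "P \<subseteq> {a..b}"
  proof (rule ccontr)
    assume out: "\<not> P \<subseteq> {a..b}"
    then obtain e where "e \<in> P" "e \<notin> {a..b}" by blast
    then have e: "e \<in> P" "e < a \<or> b < e" by auto
    have mme: "Min P \<le> e" "e \<le> Max P" using finP e by auto
    have "a \<in> P"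
    proof (cases "\<exists>x\<in>P. x \<le> a")
      case True
      then obtain x where x: "x \<in> P" "x \<le> a" by blast
      \<comment> \<open>The side leaving the range up to \<open>a\<close> ends at or before
        \<open>c\<close>, so \<open>p < a\<close> would make it cross \<open>{a, b}\<close>.\<close>
      obtain p q where pq: "p \<in> P" "q \<in> P" "p \<le> a" "a < q" "P \<inter> {p<..<q} = {}" "{p, q} \<in> sides P"
        by (rule gap_in_finite_set[OF finP x(1) c(1) x(2) c(2)])
      have "q \<le> c"
      proof (rule ccontr)
        assume "\<not> q \<le> c"
        then have "c \<in> P \<inter> {p<..<q}" using pq c by auto
        then show False using pq by blast
      qed
      then have "\<not> p < a" using crossing_pairI(1)[of p a q b] nc pq c by auto
      then show ?thesis using pq by auto
    next
      case False
      \<comment> \<open>Now the outside vertex is beyond \<open>b\<close>, and the closing side of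
        \<open>P\<close> crosses \<open>{a, b}\<close>.\<close>
      then have "a < Min P" using finP c Min_in[of P] by fastforce
      moreover have "b < Max P" using e False mme by auto
      ultimately show ?thesis using crossing_pairI(2)[of a "Min P" b "Max P"] nc mm mmc c by auto
    qed
    moreover have "b \<in> P"
    proof (cases "\<exists>x\<in>P. b \<le> x")
      case True
      then obtain x where "x \<in> P" "b \<le> x" by blast
      \<comment> \<open>Taking \<open>b - 1\<close> as the threshold turns
        \<open>p \<le> w < q\<close> into \<open>p < b \<le> q\<close>; \<open>c < b\<close> ensures
        that \<open>b\<close> is positive.\<close>
      then have x: "x \<in> P" "b - 1 < x" "c \<le> b - 1" using c by auto
      obtain p q where pq: "p \<in> P" "q \<in> P" "p \<le> b - 1" "b - 1 < q" "P \<inter> {p<..<q} = {}" "{p, q} \<in> sides P"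
        by (rule gap_in_finite_set[OF finP c(1) x(1) x(3,2)])
      have "c \<le> p"
      proof (rule ccontr)
        assume "\<not> c \<le> p"
        then have "c \<in> P \<inter> {p<..<q}" using pq c by auto
        then show False using pq by blast
      qed
      moreover have "p < b" using pq c by linarith
      ultimately have "\<not> b < q" using crossing_pairI(2)[of a p b q] nc pq c by auto
      then have "q = b" using pq by auto
      then show ?thesis using pq by auto
    next
      case False
      then have "Max P < b" using finP c Max_in[of P] by fastforce
      moreover have "Min P < a" using e False mme by auto
      ultimately show ?thesis using crossing_pairI(1)[of "Min P" a "Max P" b] nc mm mmc c by auto
    qed
    ultimately have "{a, b} \<in> diagonals P"
      using c out ab by (auto simp: pair_in_diagonals)
    then show False using P ab by blast
  qed
  then have "P \<subseteq> tip" using P by (auto simp: tip_def)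
  moreover have "sides P \<subseteq> sides tip"
    using chords_tip P(3) sides_subset_chords[of P] chords_mono[OF \<open>P \<subseteq> tip\<close>] by blast
  ultimately show ?thesis
    using polygon_eq_if_sides_subset[of tip P] P fin by (auto simp: tip_def)
qed

text \<open>Being a side or a cutting diagonal means the same for \<open>V\<close> and
  \<open>rest\<close> on chords of \<open>rest\<close>: only \<open>{a, b}\<close> changes its role,
  and it is never a diagonal of a subset of \<open>rest\<close>.\<close>

lemma pieces_rest: "P \<in> pieces rest rest_diags \<longleftrightarrow> P \<in> pieces V D \<and> P \<subseteq> rest"
proof (cases "P \<subseteq> rest")
  case True
  have "rest \<subseteq> V" by (auto simp: rest_def)
  have "c \<in> sides rest \<union> rest_diags \<longleftrightarrow> c \<in> sides V \<union> D" if "c \<in> sides P" for c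
    using that sides_rest[of c] sides_subset_chords[of P] chords_mono[OF True] ab
    by (auto simp: rest_diags_def)
  then have "sides P \<subseteq> sides rest \<union> rest_diags \<longleftrightarrow> sides P \<subseteq> sides V \<union> D" by blast
  moreover have "{a, b} \<notin> diagonals P"
    using True ab by (auto simp: pair_in_diagonals rest_def)
  then have "diagonals P \<inter> rest_diags = {} \<longleftrightarrow> diagonals P \<inter> D = {}"
    by (auto simp: rest_diags_def)
  ultimately show ?thesis using True \<open>rest \<subseteq> V\<close> by (auto simp: pieces_def)
qed (auto simp: pieces_def)

lemma tip_not_subset_rest: "\<not> tip \<subseteq> rest"
  using ab_diag by (fastforce simp: tip_def rest_def)

lemma pieces_eq: "pieces V D = insert tip (pieces rest rest_diags)"
  using tip_in_pieces piece_eq_tip pieces_rest by blast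

lemma tip_notin_pieces_rest: "tip \<notin> pieces rest rest_diags"
  using tip_not_subset_rest pieces_rest by blast

end

lemma exists_ear:
  assumes "finite V" "D \<subseteq> diagonals V" "\<And>d e. d \<in> D \<Longrightarrow> e \<in> D \<Longrightarrow> \<not> crossing d e" "D \<noteq> {}"
  obtains a b where "ear V D a b"
proof -
  obtain d where "d \<in> D" using assms by blast
  then obtain i j where "{i, j} \<in> D" "i < j"
    using assms(2) diagonals_subset_chords chordsE by (metis in_mono)
  \<comment> \<open>A member of \<open>D\<close> with shortest span is taken. Pairs are ordered by
    \<open>i < j\<close>, so the truncated difference is the true span.\<close>
  then obtain x where "(\<lambda>(i, j). i < j \<and> {i, j} \<in> D) x"
    and "\<forall>y. (\<lambda>(i, j). i < j \<and> {i, j} \<in> D) y \<longrightarrow> (\<lambda>(i, j). j - i) x \<le> (\<lambda>(i, j). j - i) y"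
    using ex_has_least_nat[of "\<lambda>(i, j). i < j \<and> {i, j} \<in> D" "(i, j)" "\<lambda>(i, j). j - i"] by auto
  moreover obtain a b where "x = (a, b)" by (cases x)
  ultimately have ab: "a < b" "{a, b} \<in> D"
    "\<And>i j. i < j \<Longrightarrow> {i, j} \<in> D \<Longrightarrow> b - a \<le> j - i"
    by auto
  have "ear V D a b"
  proof
    fix i j assume "i < j" "{i, j} \<in> D" "a \<le> i" "j \<le> b"
    moreover have "b - a \<le> j - i" using calculation ab by blast
    ultimately show "i = a \<and> j = b" using ab(1) by linarith
  qed (use assms ab in auto)
  then show thesis using that by blast
qed

section \<open>The matrix of a quiddity sequence, by induction on ears\<close>

definition piece_count :: "nat set \<Rightarrow> nat set set \<Rightarrow> nat \<Rightarrow> int" where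
  "piece_count V D v = int (card {P \<in> pieces V D. v \<in> P})"

text \<open>Induction on the number of vertices. An undissected polygon gives a sequence of ones;
  otherwise an ear is removed and \<open>M_insert_ear\<close> applies. That the pieces cover
  \<open>V\<close> is carried along to make the entries of the quiddity positive.\<close>

lemma M_piece_count:
  assumes "finite V" "3 \<le> card V" "D \<subseteq> diagonals V"
    "\<And>d e. d \<in> D \<Longrightarrow> e \<in> D \<Longrightarrow> \<not> crossing d e" "\<And>P. P \<in> pieces V D \<Longrightarrow> 3 dvd card P"
  shows "M (map (piece_count V D) (sorted_list_of_set V))
      = mat (- ((- 1) ^ card {P \<in> pieces V D. even (card P)})) \<and> V \<subseteq> \<Union> (pieces V D)"
  using assms
proof (induction "card V" arbitrary: V D rule: less_induct)
  case less
  note finV = less.prems(1)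
  show ?case
  proof (cases "D = {}")
    case True
    have p: "pieces V D = {V}" using less.prems pieces_empty True by simp
    have "piece_count V D v = 1" if "v \<in> V" for v
    proof -
      have "{P \<in> pieces V D. v \<in> P} = {V}" using p that by blast
      then show ?thesis by (simp add: piece_count_def)
    qed
    then have "map (piece_count V D) (sorted_list_of_set V) = map (\<lambda>_. 1) (sorted_list_of_set V)"
      using finV by simp
    also have "\<dots> = replicate (card V) 1"
      by (simp add: map_replicate_const)
    finally have 1: "map (piece_count V D) (sorted_list_of_set V) = replicate (card V) 1" .
    have "3 dvd card V" using less.prems(5) p by simp
    then obtain i where i: "card V = 3 * Suc i"
      using less.prems(2) by (metis dvd_def mult_0_right not_numeral_le_zero not0_implies_Suc)
    have "replicate (card V) (1 :: int) = 1 # 1 # replicate (3 * i + 1) 1"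
      unfolding i by (simp add: numeral_3_eq_3)
    then have "M (replicate (card V) 1) = mat ((- 1) ^ i) ** (elem_mat 1 ** elem_mat 1 ** elem_mat 1)"
      by (simp only: M.simps M_replicate_1 matrix_mul_assoc)
    also have "\<dots> = mat (- ((- 1) ^ i))"
      unfolding elem_mat_1_cube mat_mult_mat by simp
    also have "(- 1 :: int) ^ i = (- 1) ^ card {P \<in> pieces V D. even (card P)}"
    proof -
      \<comment> \<open>The single piece has \<open>3 * Suc i\<close> vertices, an even number
        exactly when \<open>i\<close> is odd.\<close>
      have "{P \<in> pieces V D. even (card P)} = (if even i then {} else {V})"
        using i p by auto
      then show ?thesis by simp
    qed
    finally show ?thesis using 1 p by simp
  next
    case False
    obtain a b where "ear V D a b" using exists_ear[of V D] less.prems False by metis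
    then interpret ear V D a b .
    have "rest \<subset> V" using ab_diag(3) by (auto simp: rest_def)
    then have lt: "card rest < card V" using finV psubset_card_mono by blast
    have finR: "finite rest" using finV by (simp add: rest_def)
    have IH: "M (map (piece_count rest rest_diags) (sorted_list_of_set rest))
        = mat (- ((- 1) ^ card {P \<in> pieces rest rest_diags. even (card P)}))"
      "rest \<subseteq> \<Union> (pieces rest rest_diags)"
      using less.hyps[OF lt finR card_rest rest_diags] noncrossing less.prems(5) pieces_eq
      by (auto simp: rest_diags_def)
    have cover: "V \<subseteq> \<Union> (pieces V D)"
      using IH(2) unfolding pieces_eq by (auto simp: rest_def tip_def)
    have fp: "finite (pieces rest rest_diags)" using finR finite_pieces by blast
    have cnt: "piece_count V D v = (if v \<in> tip then 1 else 0) + piece_count rest rest_diags v" for v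
    proof -
      have "{P \<in> pieces V D. v \<in> P} = (if v \<in> tip then {tip} else {}) \<union> {P \<in> pieces rest rest_diags. v \<in> P}"
        unfolding pieces_eq by auto
      then show ?thesis using fp tip_notin_pieces_rest by (auto simp: piece_count_def)
    qed
    have cnt0: "piece_count rest rest_diags v = 0" if "v \<notin> rest" for v
    proof -
      have "{P \<in> pieces rest rest_diags. v \<in> P} = {}" using that by (auto simp: pieces_def)
      then show ?thesis by (simp only: piece_count_def) simp
    qed
    \<comment> \<open>In sorted order the inner vertices of the ear form a contiguous block
      \<open>I\<close> between \<open>a\<close> and \<open>b\<close>, matching the shape of
      \<open>M_insert_ear\<close>.\<close>
    define L I R where "L = sorted_list_of_set (V \<inter> {..<a})"
      and "I = sorted_list_of_set (V \<inter> {a<..<b})" and "R = sorted_list_of_set (V \<inter> {b<..})"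
    have listV: "sorted_list_of_set V = L @ [a] @ I @ [b] @ R"
    proof (rule sorted_distinct_set_unique)
      show "set (sorted_list_of_set V) = set (L @ [a] @ I @ [b] @ R)"
        using finV ab_diag ab by (auto simp: L_def I_def R_def)
    qed (use finV ab in \<open>auto simp: sorted_append L_def I_def R_def\<close>)
    have listR: "sorted_list_of_set rest = L @ [a] @ [b] @ R"
    proof (rule sorted_distinct_set_unique)
      show "set (sorted_list_of_set rest) = set (L @ [a] @ [b] @ R)"
        using finV ab_diag ab by (auto simp: L_def R_def rest_def)
    qed (use finV ab in \<open>auto simp: sorted_append L_def R_def\<close>)
    let ?q = "piece_count rest rest_diags"
    have "map (piece_count V D) L = map ?q L" "map (piece_count V D) R = map ?q R"
      using finV by (auto simp: L_def R_def cnt tip_def)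
    \<comment> \<open>The removed vertices belong to no piece other than \<open>tip\<close>.\<close>
    moreover have "piece_count V D v = 1" if "v \<in> V \<inter> {a<..<b}" for v
    proof -
      have "v \<in> tip" "v \<notin> rest" using that by (auto simp: tip_def rest_def)
      then show ?thesis using cnt cnt0 by simp
    qed
    then have "map (piece_count V D) I = map (\<lambda>_. 1) I"
      using finV by (simp add: I_def)
    moreover have "map (\<lambda>_. 1 :: int) I = replicate (card (V \<inter> {a<..<b})) 1"
      by (simp add: map_replicate_const I_def)
    ultimately have q: "map (piece_count V D) (sorted_list_of_set V)
        = map ?q L @ [?q a + 1] @ replicate (card (V \<inter> {a<..<b})) 1 @ [?q b + 1] @ map ?q R"
      unfolding listV using ab ab_diag by (simp add: cnt tip_def)
    have "tip = insert a (insert b (V \<inter> {a<..<b}))" using ab ab_diag by (auto simp: tip_def)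
    then have ctip: "card tip = card (V \<inter> {a<..<b}) + 2" using finV ab by simp
    have "3 dvd card tip" using less.prems(5) tip_in_pieces by blast
    then obtain i where i: "card tip = 3 * Suc i"
      using card_tip by (metis dvd_def mult_0_right not_numeral_le_zero not0_implies_Suc)
    then have ci: "card (V \<inter> {a<..<b}) = 3 * i + 1" using ctip by simp
    have "M (map (piece_count V D) (sorted_list_of_set V))
        = mat ((- 1) ^ i) ** M (map ?q (sorted_list_of_set rest))"
      unfolding q ci M_insert_ear listR by simp
    also have "\<dots> = mat (- ((- 1) ^ (i + card {P \<in> pieces rest rest_diags. even (card P)})))"
      unfolding IH(1) mat_mult_mat by (simp add: power_add)
    also have "(- 1 :: int) ^ (i + card {P \<in> pieces rest rest_diags. even (card P)})
        = (- 1) ^ card {P \<in> pieces V D. even (card P)}"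
    proof -
      \<comment> \<open>The sign \<open>(-1) ^ i\<close> from the ear is -1 exactly when
        \<open>tip\<close> has evenly many vertices.\<close>
      have "{P \<in> pieces V D. even (card P)}
          = (if even i then {} else {tip}) \<union> {P \<in> pieces rest rest_diags. even (card P)}"
        unfolding pieces_eq using i by auto
      then show ?thesis using fp tip_notin_pieces_rest by (auto simp: power_add)
    qed
    finally show ?thesis using cover by blast
  qed
qed

lemma quiddity_eq: "quiddity n D = map (piece_count {1..n} D) (sorted_list_of_set {1..n})"
  by (simp add: quiddity_def piece_count_def subpolygons_eq_pieces atLeastLessThanSuc_atLeastAtMost
      del: upt_Suc flip: sorted_list_of_set_range)

lemma M_quiddity:
  assumes "3 \<le> n" "dissection_3d n D"
  shows "M (quiddity n D) = mat (if even_dissection n D then - 1 else 1)"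
    and "\<forall>x\<in>set (quiddity n D). 0 < x" and "length (quiddity n D) = n"
proof -
  have main: "M (quiddity n D) = mat (- ((- 1) ^ card {P \<in> pieces {1..n} D. even (card P)}))"
    "{1..n} \<subseteq> \<Union> (pieces {1..n} D)"
    using M_piece_count[of "{1..n}" D] assms
    by (auto simp: dissection_3d_def dissection_def quiddity_eq subpolygons_eq_pieces)
  then show "M (quiddity n D) = mat (if even_dissection n D then - 1 else 1)"
    by (simp add: even_dissection_def subpolygons_eq_pieces)
  show "\<forall>x\<in>set (quiddity n D). 0 < x"
    using main(2) finite_pieces[of "{1..n}" D]
    by (fastforce simp: quiddity_def subpolygons_eq_pieces card_gt_0_iff)
  show "length (quiddity n D) = n" by (simp add: quiddity_def)
qed

section \<open>The products as insertions into lists\<close>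

lemma map_nth_minus_1:
  assumes "1 \<le> p" "q \<le> length xs + 1"
  shows "map (\<lambda>i. xs ! (i - 1)) [p..<q] = drop (p - 1) (take (q - 1) xs)"
  using assms by (intro nth_equalityI) auto

lemma circ_prod_less:
  "circ_prod (length A + 1) (A @ [s, s'] @ B) (u # X @ [v]) = A @ [s + u + 1] @ X @ [v + 1, s' + 1] @ B"
  unfolding circ_prod_def Let_def
  by (simp add: map_nth_minus_1[simplified] del: upt_Suc) (simp add: nth_append)

text \<open>Here \<open>k\<close> is the length of the first list, and the cyclically consecutive
  entries \<open>s\<close>, \<open>s'\<close> sit at its end and its beginning.\<close>

lemma circ_prod_last:
  "circ_prod (length B + 2) (s' # B @ [s]) (u # X @ [v]) = [s' + 1] @ B @ [s + u + 1] @ X @ [v + 1]"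
  unfolding circ_prod_def Let_def
  by (simp add: map_nth_minus_1[simplified] del: upt_Suc)

lemma bullet_prod_greater:
  "bullet_prod (length A + 2) (A @ [s, s'] @ B) (v # u # X) = A @ [s + 1, u + 1] @ X @ [s' + v + 1] @ B"
  unfolding bullet_prod_def Let_def
  by (simp add: map_nth_minus_1[simplified] del: upt_Suc) (simp add: nth_append)

lemma bullet_prod_1:
  "bullet_prod 1 (s' # B @ [s]) (v # u # X) = [s' + v + 1] @ B @ [s + 1, u + 1] @ X"
  unfolding bullet_prod_def Let_def
  by (simp add: map_nth_minus_1[simplified] del: upt_Suc)

lemma split_consecutive:
  assumes "i + 2 \<le> length xs"
  obtains A s s' B where "xs = A @ [s, s'] @ B" "length A = i"
proof
  show "xs = take i xs @ [xs ! i, xs ! Suc i] @ drop (i + 2) xs"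
    using assms by (simp add: Cons_nth_drop_Suc)
qed (use assms in auto)

lemma split_ends:
  assumes "2 \<le> length xs"
  obtains x B y where "xs = x # B @ [y]"
proof -
  obtain x ys where "xs = x # ys" using assms by (cases xs) auto
  moreover obtain B y where "ys = B @ [y]"
    using assms calculation by (cases ys rule: rev_cases) auto
  ultimately show thesis using that by blast
qed

section \<open>The products solve the equation\<close>

text \<open>Both matrices are the same scalar \<open>c\<close>, so gluing yields the scalar
  \<open>- c * c = -1\<close>. For \<open>k = length S\<close> the triangle is attached across the
  ends of the list: rotation makes them adjacent, and the result is rotated back.\<close>

lemma positive_solution_circ_prod:
  assumes "M S = mat c" "M T = mat c" "c * c = 1" "\<forall>x\<in>set S. 0 < x" "\<forall>x\<in>set T. 0 < x"
    and "2 \<le> length S" "2 \<le> length T" "1 \<le> k" "k \<le> length S"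
  shows "positive_solution (length S + length T - 1) (circ_prod k S T)"
proof -
  obtain u X v where T: "T = u # X @ [v]" by (rule split_ends[OF assms(7)])
  have MT: "M (u # X @ [v]) = mat c" using assms(2) T by simp
  show ?thesis
  proof (cases "k < length S")
    case True
    then have "k - 1 + 2 \<le> length S" using assms(8) by simp
    then obtain A s s' B where S: "S = A @ [s, s'] @ B" "length A = k - 1"
      by (rule split_consecutive)
    then have k: "k = length A + 1" using assms(8) by simp
    have eq: "circ_prod k S T = A @ [s + u + 1] @ X @ [v + 1, s' + 1] @ B"
      unfolding T S(1) k by (rule circ_prod_less)
    have "M (circ_prod k S T) = mat (- 1)"
      unfolding eq M_circ[OF MT] S(1)[symmetric] assms(1) mat_mult_mat using assms(3) by simp
    moreover have "\<forall>x\<in>set (circ_prod k S T). 0 < x"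
      unfolding eq using assms(4,5) T S(1) by auto
    moreover have "length (circ_prod k S T) = length S + length T - 1"
      unfolding eq using T S(1) by simp
    ultimately show ?thesis
      unfolding positive_solution_def neg_mat by blast
  next
    case False
    obtain s' B s where S: "S = s' # B @ [s]" by (rule split_ends[OF assms(6)])
    then have k: "k = length B + 2" using False assms(9) by simp
    have eq: "circ_prod k S T = [s' + 1] @ B @ [s + u + 1] @ X @ [v + 1]"
      unfolding T S k by (rule circ_prod_last)
    have "M ([s] @ s' # B) = mat c" using M_rotate[of "s' # B" "[s]"] assms(1) S by simp
    then have "M ([s + u + 1] @ X @ [v + 1, s' + 1] @ B) = mat (- 1)"
      using M_circ[OF MT, of "[]" s s' B] assms(3) by (simp add: mat_mult_mat)
    then have "M (circ_prod k S T) = mat (- 1)"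
      unfolding eq using M_rotate[of "[s + u + 1] @ X @ [v + 1]" "[s' + 1] @ B"] by simp
    moreover have "\<forall>x\<in>set (circ_prod k S T). 0 < x"
      unfolding eq using assms(4,5) T S by auto
    moreover have "length (circ_prod k S T) = length S + length T - 1"
      unfolding eq using T S by simp
    ultimately show ?thesis
      unfolding positive_solution_def neg_mat by blast
  qed
qed

lemma positive_solution_bullet_prod:
  assumes "M S = mat c" "M T = mat c" "c * c = 1" "\<forall>x\<in>set S. 0 < x" "\<forall>x\<in>set T. 0 < x"
    and "2 \<le> length S" "2 \<le> length T" "1 \<le> k" "k \<le> length S"
  shows "positive_solution (length S + length T - 1) (bullet_prod k S T)"
proof -
  obtain v u X where T: "T = v # u # X"
    using assms(7) by (cases T; cases "tl T") auto
  \<comment> \<open>The bullet product traverses the second sequence from its second entry and ends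
    with the first, hence this rotation.\<close>
  have MT: "M (u # X @ [v]) = mat c" using M_rotate[of "[v]" "u # X"] assms(2) T by simp
  show ?thesis
  proof (cases "2 \<le> k")
    case True
    then have "k - 2 + 2 \<le> length S" using assms(9) by simp
    then obtain A s s' B where S: "S = A @ [s, s'] @ B" "length A = k - 2"
      by (rule split_consecutive)
    then have k: "k = length A + 2" using True by simp
    have eq: "bullet_prod k S T = A @ [s + 1, u + 1] @ X @ [s' + v + 1] @ B"
      unfolding T S(1) k by (rule bullet_prod_greater)
    have "M (bullet_prod k S T) = mat (- 1)"
      unfolding eq M_bullet[OF MT] S(1)[symmetric] assms(1) mat_mult_mat using assms(3) by simp
    moreover have "\<forall>x\<in>set (bullet_prod k S T). 0 < x"
      unfolding eq using assms(4,5) T S(1) by auto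
    moreover have "length (bullet_prod k S T) = length S + length T - 1"
      unfolding eq using T S(1) by simp
    ultimately show ?thesis
      unfolding positive_solution_def neg_mat by blast
  next
    case False
    then have k: "k = 1" using assms(8) by simp
    \<comment> \<open>For \<open>k = 1\<close> the pair of neighbours is the last entry followed by
      the first.\<close>
    obtain s' B s where S: "S = s' # B @ [s]" by (rule split_ends[OF assms(6)])
    have eq: "bullet_prod k S T = [s' + v + 1] @ B @ [s + 1, u + 1] @ X"
      unfolding T S k by (rule bullet_prod_1)
    have "M ([s] @ s' # B) = mat c" using M_rotate[of "s' # B" "[s]"] assms(1) S by simp
    then have "M ([s + 1, u + 1] @ X @ [s' + v + 1] @ B) = mat (- 1)"
      using M_bullet[OF MT, of "[]" s s' B] assms(3) by (simp add: mat_mult_mat)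
    then have "M (bullet_prod k S T) = mat (- 1)"
      unfolding eq using M_rotate[of "[s + 1, u + 1] @ X" "[s' + v + 1] @ B"] by simp
    moreover have "\<forall>x\<in>set (bullet_prod k S T). 0 < x"
      unfolding eq using assms(4,5) T S by auto
    moreover have "length (bullet_prod k S T) = length S + length T - 1"
      unfolding eq using T S by simp
    ultimately show ?thesis
      unfolding positive_solution_def neg_mat by blast
  qed
qed

theorem theorem11:
  fixes n m k :: nat and D E :: "nat set set" and S T :: "int list"
  assumes "n \<ge> 3" and "m \<ge> 3"
    and "dissection_3d n D" and "dissection_3d m E"
    and "S = quiddity n D" and "T = quiddity m E"
    and "(even_dissection n D \<and> even_dissection m E) \<or>
         (\<not> even_dissection n D \<and> \<not> even_dissection m E)"
    and "1 \<le> k" and "k \<le> n"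
  shows "positive_solution (n + m - 1) (circ_prod k S T) \<and>
         positive_solution (n + m - 1) (bullet_prod k S T)"
proof -
  \<comment> \<open>By equal parity this is the scalar of both sequences.\<close>
  define c :: int where "c = (if even_dissection n D then - 1 else 1)"
  have "c * c = 1" by (simp add: c_def)
  have S: "M S = mat c" "\<forall>x\<in>set S. 0 < x" "length S = n"
    using M_quiddity[OF assms(1,3)] assms(5) by (simp_all add: c_def)
  have T: "M T = mat c" "\<forall>x\<in>set T. 0 < x" "length T = m"
    using M_quiddity[OF assms(2,4)] assms(6,7) by (auto simp: c_def)
  show ?thesis
    using positive_solution_circ_prod[OF S(1) T(1) \<open>c * c = 1\<close> S(2) T(2), of k]
      positive_solution_bullet_prod[OF S(1) T(1) \<open>c * c = 1\<close> S(2) T(2), of k]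
      S(3) T(3) assms(1,2,8,9) by simp
qed

end
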